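(* Let $\mathbf{a}$ be a weak composition. Then $\mathcal{P}(\mathbb{D}(\mathbf{a}))$ is ranked if and only if $\mathbf{a}$ is pure.
   Context: A diagram is a finite set $D$ of cells $(r,c)$ with $r,c$ positive integers; $r$ is the row (rows numbered from bottom to top starting at 1) and $c$ the column (numbered from left to right starting at 1). A Kohnert move at row $r$ applied to a diagram $D$: if row $r$ of $D$ is empty, $D$ is unchanged; otherwise let $(r,c)$ be the cell of row $r$ with the largest column index; if every position $(r',c)$ with $1\le r'<r$ belongs to $D$, then $D$ is unchanged; otherwise let $r'$ be the largest integer with $1\le r'<r$ and $(r',c)\notin D$, and the move replaces the cell $(r,c)$ by $(r',c)$. For a diagram $D_0$, $KD(D_0)$ is the set of all diagrams obtainable from $D_0$ by finite (possibly empty) sequences of Kohnert moves; the Kohnert poset $\mathcal{P}(D_0)$ is $KD(D_0)$ ordered by $D_2\preceq D_1$ iff $D_2$ can be obtained from $D_1$ by a finite sequence of Kohnert moves. A finite poset $P$ is ranked if there is a function $\rho:P\to\mathbb{Z}_{\ge0}$ such that $x\prec y$ implies $\rho(x)<\rho(y)$ and $\rho(y)=\rho(x)+1$ whenever $y$ covers $x$. For a weak composition $\mathbf{a}=(a_1,\dots,a_n)\in\mathbb{Z}_{\ge0}^n$, the key diagram is $\mathbb{D}(\mathbf{a})=\bigcup_{i=1}^n\{(i,j):1\le j\le a_i\}$. The weak composition $\mathbf{a}$ is pure if there are no indices $1\le j_1<j_2<j_3\le n$ with $a_{j_1}<a_{j_2}<a_{j_3}$, or $a_{j_1}<a_{j_3}<a_{j_2}$,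 or $a_{j_1}+1<a_{j_2}=a_{j_3}$. *)

theory Defs
  imports Main
begin

text \<open>A cell is a pair (row, column). Rows are numbered from bottom to top and columns
  from left to right, both starting at 1.\<close>

type_synonym cell = "nat \<times> nat"

definition diagram :: "cell set \<Rightarrow> bool" where
  "diagram D \<longleftrightarrow> finite D \<and> (\<forall>(r, c) \<in> D. 1 \<le> r \<and> 1 \<le> c)"

definition kohnert_move :: "nat \<Rightarrow> cell set \<Rightarrow> cell set" where
  "kohnert_move r D =
     (if {c. (r, c) \<in> D} = {} then D
      else let c = Max {c. (r, c) \<in> D};
               free = {r'. 1 \<le> r' \<and> r' < r \<and> (r', c) \<notin> D}
           in if free = {} then D
              else insert (Max free, c) (D - {(r, c)}))"

definition kohnert_step :: "cell set \<Rightarrow> cell set \<Rightarrow> bool" where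
  "kohnert_step D D' \<longleftrightarrow> (\<exists>r \<ge> 1. D' = kohnert_move r D)"

definition KD :: "cell set \<Rightarrow> cell set set" where
  "KD D0 = {D. kohnert_step\<^sup>*\<^sup>* D0 D}"

text \<open>The order relation of the Kohnert poset with ground set \<open>KD D0\<close>: a pair
  \<open>(D2, D1)\<close> in the relation means that \<open>D2\<close> is below \<open>D1\<close>.\<close>

definition kohnert_order :: "cell set \<Rightarrow> cell set rel" where
  "kohnert_order D0 = {(D2, D1). D2 \<in> KD D0 \<and> D1 \<in> KD D0 \<and> kohnert_step\<^sup>*\<^sup>* D1 D2}"

definition covers :: "'a set \<Rightarrow> 'a rel \<Rightarrow> 'a \<Rightarrow> 'a \<Rightarrow> bool" where
  "covers P le y x \<longleftrightarrow> x \<in> P \<and> y \<in> P \<and> (x, y) \<in> le \<and> x \<noteq> y \<and>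
     \<not> (\<exists>z \<in> P. (x, z) \<in> le \<and> x \<noteq> z \<and> (z, y) \<in> le \<and> z \<noteq> y)"

text \<open>Meant for a finite set \<open>P\<close> partially ordered by \<open>le\<close>; that Kohnert posets are of
  this kind is shown below.\<close>

definition ranked :: "'a set \<Rightarrow> 'a rel \<Rightarrow> bool" where
  "ranked P le \<longleftrightarrow> (\<exists>\<rho> :: 'a \<Rightarrow> nat.
     (\<forall>x \<in> P. \<forall>y \<in> P. (x, y) \<in> le \<and> x \<noteq> y \<longrightarrow> \<rho> x < \<rho> y) \<and>
     (\<forall>x \<in> P. \<forall>y \<in> P. covers P le y x \<longrightarrow> \<rho> y = \<rho> x + 1))"

text \<open>A weak composition is a list of natural numbers. Its \<open>i\<close>-th part, counted from 1, is
  \<open>a ! (i - 1)\<close>.\<close>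

definition key_diagram :: "nat list \<Rightarrow> cell set" where
  "key_diagram a = (\<Union>i \<in> {1..length a}. {(i, j) |j. 1 \<le> j \<and> j \<le> a ! (i - 1)})"

text \<open>The indices are the list positions, counted from 0; only their relative order
  matters here.\<close>

definition pure_composition :: "nat list \<Rightarrow> bool" where
  "pure_composition a \<longleftrightarrow>
     \<not> (\<exists>j1 j2 j3. j1 < j2 \<and> j2 < j3 \<and> j3 < length a \<and>
          (a ! j1 < a ! j2 \<and> a ! j2 < a ! j3 \<or>
           a ! j1 < a ! j3 \<and> a ! j3 < a ! j2 \<or>
           a ! j1 + 1 < a ! j2 \<and> a ! j2 = a ! j3))"

lemma diagram_key_diagram: "diagram (key_diagram a)"
proof -
  have "finite {(i, j) |j. 1 \<le> j \<and> j \<le> a ! (i - 1)}" for i :: nat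
    by (rule finite_subset[of _ "{i} \<times> {..a ! (i - 1)}"]) auto
  then show ?thesis
    by (auto simp: diagram_def key_diagram_def)
qed

lemma kohnert_move_cases:
  assumes "diagram D"
  obtains "kohnert_move r D = D"
  | r' c where "(r, c) \<in> D" "\<And>c'. (r, c') \<in> D \<Longrightarrow> c' \<le> c" "1 \<le> r'" "r' < r" "(r', c) \<notin> D"
      "kohnert_move r D = insert (r', c) (D - {(r, c)})"
proof -
  define C where "C = {c. (r, c) \<in> D}"
  define c where "c = Max C"
  define F where "F = {r'. 1 \<le> r' \<and> r' < r \<and> (r', c) \<notin> D}"
  have move: "kohnert_move r D =
      (if C = {} then D else if F = {} then D else insert (Max F, c) (D - {(r, c)}))"
    by (simp only: kohnert_move_def C_def c_def F_def Let_def)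
  have "C \<subseteq> snd ` D" by (force simp: C_def)
  then have finC: "finite C"
    using assms by (meson diagram_def finite_imageI finite_subset)
  show thesis
  proof (cases "C = {} \<or> F = {}")
    case True
    then have "kohnert_move r D = D" by (auto simp: move)
    then show thesis by (rule that(1))
  next
    case False
    have "finite F" by (simp add: F_def)
    then have "Max F \<in> F" using False by (simp add: Max_in)
    moreover have "c \<in> C" using finC False by (simp add: c_def Max_in)
    moreover have "c' \<le> c" if "(r, c') \<in> D" for c'
      using that finC by (simp add: c_def C_def)
    moreover have "kohnert_move r D = insert (Max F, c) (D - {(r, c)})"
      using False by (simp add: move)
    ultimately show thesis
      by (intro that(2)[of c "Max F"]) (simp_all only: F_def C_def mem_Collect_eq simp_thms)
  qed
qed

definition row_sum :: "cell set \<Rightarrow> nat" where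
  "row_sum D = (\<Sum>p \<in> D. fst p)"

lemma kohnert_step_props:
  assumes D: "diagram D" and step: "kohnert_step D D'"
  shows "diagram D'" "D' = D \<or> row_sum D' < row_sum D"
    "D \<subseteq> {..m} \<times> {..n} \<Longrightarrow> D' \<subseteq> {..m} \<times> {..n}"
proof -
  obtain r where D': "D' = kohnert_move r D"
    using step by (auto simp: kohnert_step_def)
  have "diagram D' \<and> (D' = D \<or> row_sum D' < row_sum D) \<and>
      (D \<subseteq> {..m} \<times> {..n} \<longrightarrow> D' \<subseteq> {..m} \<times> {..n})"
    using D
  proof (cases rule: kohnert_move_cases[of D r])
    case 1
    then show ?thesis using D D' by simp
  next
    case (2 r' c)
    have fin: "finite D" using D by (simp add: diagram_def)
    have "row_sum D = r + row_sum (D - {(r, c)})"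
      using fin 2(1) by (simp add: row_sum_def sum.remove)
    moreover have "row_sum D' = r' + row_sum (D - {(r, c)})"
      using fin 2 by (simp add: D' row_sum_def)
    ultimately have "row_sum D' < row_sum D" using 2(4) by simp
    moreover have "diagram D'" using D 2 by (auto simp: D' diagram_def)
    moreover have "D \<subseteq> {..m} \<times> {..n} \<longrightarrow> D' \<subseteq> {..m} \<times> {..n}"
      using 2 by (auto simp: D')
    ultimately show ?thesis by simp
  qed
  then show "diagram D'" "D' = D \<or> row_sum D' < row_sum D"
    "D \<subseteq> {..m} \<times> {..n} \<Longrightarrow> D' \<subseteq> {..m} \<times> {..n}" by auto
qed

lemma kohnert_steps_props:
  assumes "kohnert_step\<^sup>*\<^sup>* D D'" "diagram D"
  shows "diagram D' \<and> (D' = D \<or> row_sum D' < row_sum D) \<and>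
    (D \<subseteq> {..m} \<times> {..n} \<longrightarrow> D' \<subseteq> {..m} \<times> {..n})"
  using assms
proof (induction rule: rtranclp_induct)
  case base
  then show ?case by simp
next
  case (step E F)
  then show ?case
    using kohnert_step_props(1,2)[of E F] kohnert_step_props(3)[of E F m n] by auto
qed

lemma finite_KD:
  assumes "diagram D0"
  shows "finite (KD D0)"
proof -
  define m n where "m = Max (fst ` D0)" and "n = Max (snd ` D0)"
  have "finite D0" using assms by (simp add: diagram_def)
  then have "D0 \<subseteq> {..m} \<times> {..n}"
    by (force simp: m_def n_def intro: Max_ge)
  then have "KD D0 \<subseteq> Pow ({..m} \<times> {..n})"
    using kohnert_steps_props[OF _ assms, of _ m n] by (auto simp: KD_def)
  then show ?thesis by (rule finite_subset) simp
qed

lemma partial_order_on_kohnert_order: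
  assumes "diagram D0"
  shows "partial_order_on (KD D0) (kohnert_order D0)"
proof -
  have "D = E" if "(D, E) \<in> kohnert_order D0" "(E, D) \<in> kohnert_order D0" for D E
  proof -
    have steps: "kohnert_step\<^sup>*\<^sup>* D0 D" "kohnert_step\<^sup>*\<^sup>* D0 E" "kohnert_step\<^sup>*\<^sup>* E D" "kohnert_step\<^sup>*\<^sup>* D E"
      using that by (auto simp: kohnert_order_def KD_def)
    then have diag: "diagram D" "diagram E"
      using kohnert_steps_props[OF _ assms] by blast+
    have "D = E \<or> row_sum D < row_sum E"
      using kohnert_steps_props[OF steps(3) diag(2)] by blast
    moreover have "E = D \<or> row_sum E < row_sum D"
      using kohnert_steps_props[OF steps(4) diag(1)] by blast
    ultimately show ?thesis by auto
  qed
  then have "antisym (kohnert_order D0)" by (auto intro: antisymI)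
  moreover have "trans (kohnert_order D0)"
    by (auto simp: trans_def kohnert_order_def)
  moreover have "refl_on (KD D0) (kohnert_order D0)"
    by (auto simp: refl_on_def kohnert_order_def)
  moreover have "kohnert_order D0 \<subseteq> KD D0 \<times> KD D0"
    by (auto simp: kohnert_order_def)
  ultimately show ?thesis
    by (simp add: partial_order_on_def preorder_on_def)
qed

end

theory Submission
  imports Defs
begin

text \<open>A Kohnert move that jumps over several cells of its column factors through smaller moves
  unless each of these cells is blocked by a cell to its right. Let a blocked jump in column
  \<open>c\<close> leave an empty position in row \<open>q\<close>, with row \<open>q + 1\<close> blocked. In a key diagram every column
  dominates the next one in the number of cells above any given row; Kohnert moves preserve this,
  they do not increase these numbers, and they never make a hole in a column that is full up to
  row \<open>q\<close>. Hence \<open>a\<close> has a part smaller than \<open>c\<close> among the first \<open>q\<close> and, after these, two parts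
  at least \<open>c\<close>, one of which exceeds \<open>c\<close>: it is not pure. So for pure \<open>a\<close> all covers lower the sum
  of the row indices by one, and this sum is a rank function.

  Conversely, an extremal forbidden pattern can be moved by one-row drops into three consecutive
  rows, of which, in the columns \<open>\<ge> c\<close>, the lowest is empty and the other two contain
  \<open>c\<close>, not both alone. Lowering both rows by one is possible by one-row drops only, and also by
  a chain in which one cover is a blocked jump of two rows; a rank function cannot serve both.\<close>

section \<open>Single Kohnert moves\<close>

text \<open>These are exactly the data of the Kohnert moves that change a diagram, freed from
  \<open>Max\<close>.\<close>

definition drops :: "cell set \<Rightarrow> nat \<Rightarrow> nat \<Rightarrow> nat \<Rightarrow> bool" where
  "drops D r r' c \<longleftrightarrow> (r, c) \<in> D \<and> (\<forall>c'. (r, c') \<in> D \<longrightarrow> c' \<le> c) \<and> 1 \<le> r' \<and> r' < r \<and>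
     (r', c) \<notin> D \<and> (\<forall>s. r' < s \<longrightarrow> s < r \<longrightarrow> (s, c) \<in> D)"

lemma kohnert_step_drops:
  assumes "drops D r r' c"
  shows "kohnert_step D (insert (r', c) (D - {(r, c)}))"
proof -
  have "Max {c. (r, c) \<in> D} = c"
    by (rule Max_eqI) (use assms in \<open>auto simp: drops_def intro: finite_subset[of _ "{..c}"]\<close>)
  moreover have "Max {s. 1 \<le> s \<and> s < r \<and> (s, c) \<notin> D} = r'"
    by (rule Max_eqI) (use assms in \<open>auto simp: drops_def intro: leI\<close>)
  ultimately have "kohnert_move r D = insert (r', c) (D - {(r, c)})"
    using assms by (auto simp: kohnert_move_def Let_def drops_def)
  then show ?thesis
    using assms by (auto simp: kohnert_step_def drops_def intro!: exI[of _ r])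
qed

text \<open>Sharper than \<open>kohnert_move_cases\<close>: \<open>drops\<close> also records that
  every position jumped over is occupied. Both the column invariant and the factorization of jumps
  rest on this.\<close>

lemma kohnert_step_cases:
  assumes "kohnert_step D D'" "diagram D"
  obtains "D' = D" | r r' c where "drops D r r' c" "D' = insert (r', c) (D - {(r, c)})"
proof -
  obtain r where D': "D' = kohnert_move r D"
    using assms by (auto simp: kohnert_step_def)
  define C where "C = {c. (r, c) \<in> D}"
  define c where "c = Max C"
  define F where "F = {r'. 1 \<le> r' \<and> r' < r \<and> (r', c) \<notin> D}"
  define f where "f = Max F"
  have D'_eq: "D' = (if C = {} then D else if F = {} then D else insert (f, c) (D - {(r, c)}))"
    by (simp only: D' kohnert_move_def C_def c_def F_def f_def Let_def)
  have "C \<subseteq> snd ` D" by (force simp: C_def)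
  then have finC: "finite C"
    using assms(2) by (meson diagram_def finite_imageI finite_subset)
  have finF: "finite F" by (simp add: F_def)
  show thesis
  proof (cases "C = {} \<or> F = {}")
    case True
    then show thesis using that(1) D'_eq by auto
  next
    case False
    then have mem: "c \<in> C" "f \<in> F" using finC finF by (auto simp: c_def f_def)
    have "(s, c) \<in> D" if "f < s" "s < r" for s
      using Max_ge[OF finF, of s, folded f_def] that by (fastforce simp: F_def)
    moreover have "c' \<le> c" if "(r, c') \<in> D" for c'
      using Max_ge[OF finC, of c', folded c_def] that by (simp add: C_def)
    ultimately have "drops D r f c"
      using mem unfolding drops_def by (simp add: C_def F_def)
    then show thesis by (rule that(2)) (use False in \<open>simp add: D'_eq\<close>)
  qed
qed

lemma row_sum_drop:
  assumes "drops D r r' c" "diagram D"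
  shows "row_sum D + r' = row_sum (insert (r', c) (D - {(r, c)})) + r"
proof -
  have fin: "finite D" using assms by (simp add: diagram_def)
  then have "row_sum D = r + row_sum (D - {(r, c)})"
    using assms by (auto simp: row_sum_def drops_def sum.remove)
  then show ?thesis
    using fin assms by (simp add: row_sum_def drops_def)
qed

lemma diagram_KD:
  assumes "D \<in> KD D0" "diagram D0"
  shows "diagram D"
  using kohnert_steps_props[of D0 D] assms by (auto simp: KD_def)

lemma KD_steps:
  assumes "D \<in> KD D0" "kohnert_step\<^sup>*\<^sup>* D E"
  shows "E \<in> KD D0"
  using assms by (auto simp: KD_def)

lemma row_sum_less:
  assumes "kohnert_step\<^sup>*\<^sup>* D E" "diagram D" "E \<noteq> D"
  shows "row_sum E < row_sum D"
  using kohnert_steps_props[OF assms(1,2)] assms(3) by blast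

text \<open>A Kohnert move may leave the diagram unchanged; this skips such moves at the start of a
  sequence.\<close>

lemma steps_first:
  assumes "kohnert_step\<^sup>*\<^sup>* D E" "E \<noteq> D"
  obtains Z where "kohnert_step D Z" "Z \<noteq> D" "kohnert_step\<^sup>*\<^sup>* Z E"
  using assms
proof (induction rule: converse_rtranclp_induct)
  case base
  then show ?case by simp
next
  case (step D F)
  then show ?case by metis
qed

section \<open>Pure compositions\<close>

text \<open>Merges the three forbidden configurations. With \<open>c = Suc (a ! j)\<close>, two
  later parts reach column \<open>c\<close> and at least one of them goes beyond it, whatever the
  order of the two.\<close>

definition pattern :: "nat list \<Rightarrow> nat \<Rightarrow> nat \<Rightarrow> nat \<Rightarrow> bool" where
  "pattern a j p u \<longleftrightarrow> j < p \<and> p < u \<and> u < length a \<and> a ! j < a ! p \<and> a ! j < a ! u \<and>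
     (Suc (a ! j) < a ! p \<or> Suc (a ! j) < a ! u)"

lemma pure_composition_iff: "pure_composition a \<longleftrightarrow> \<not> (\<exists>j p u. pattern a j p u)"
proof -
  have "pattern a j p u \<longleftrightarrow> j < p \<and> p < u \<and> u < length a \<and>
     (a ! j < a ! p \<and> a ! p < a ! u \<or> a ! j < a ! u \<and> a ! u < a ! p \<or>
      a ! j + 1 < a ! p \<and> a ! p = a ! u)" for j p u
    unfolding pattern_def by linarith
  then show ?thesis by (simp add: pure_composition_def)
qed

section \<open>Column counts and the invariants of diagrams below a key diagram\<close>

lemma mem_key_diagram:
  "(i, c) \<in> key_diagram a \<longleftrightarrow> 1 \<le> i \<and> i \<le> length a \<and> 1 \<le> c \<and> c \<le> a ! (i - 1)"
  by (auto simp: key_diagram_def)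

definition height_count :: "cell set \<Rightarrow> nat \<Rightarrow> nat \<Rightarrow> nat" where
  "height_count D c k = card {r. k \<le> r \<and> (r, c) \<in> D}"

lemma finite_column:
  assumes "diagram D"
  shows "finite {r. P r \<and> (r, c) \<in> D}"
proof (rule finite_subset)
  show "{r. P r \<and> (r, c) \<in> D} \<subseteq> fst ` D" by force
  show "finite (fst ` D)" using assms by (simp add: diagram_def)
qed

lemma height_count_pos:
  assumes "diagram D"
  shows "0 < height_count D c k \<longleftrightarrow> (\<exists>r \<ge> k. (r, c) \<in> D)"
  using finite_column[OF assms, of "\<lambda>r. k \<le> r" c] by (auto simp: height_count_def card_gt_0_iff)

text \<open>A count changes only when the falling cell crosses level \<open>k\<close>. The additive
  form avoids truncated subtraction.\<close>

lemma height_count_drop: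
  assumes d: "drops D r r' c" and D: "diagram D"
  shows "height_count D b k = height_count (insert (r', c) (D - {(r, c)})) b k
           + (if b = c \<and> r' < k \<and> k \<le> r then 1 else 0)"
proof -
  let ?D' = "insert (r', c) (D - {(r, c)})"
  let ?A = "{s. k \<le> s \<and> (s, b) \<in> D}" and ?B = "{s. k \<le> s \<and> (s, b) \<in> ?D'}"
  note fin = finite_column[OF D, of "\<lambda>s. k \<le> s" b]
  consider "b \<noteq> c \<or> r < k" | "b = c" "r' < k" "k \<le> r" | "b = c" "k \<le> r'" using d by linarith
  then show ?thesis
  proof cases
    case 1
    then have "?B = ?A" using d by (auto simp: drops_def)
    then show ?thesis using 1 by (auto simp: height_count_def)
  next
    case 2
    then have B: "?B = ?A - {r}" and r: "r \<in> ?A" using d by (auto simp: drops_def)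
    have "card ?A = card ?B + 1" unfolding B using card.remove[OF fin r] by linarith
    then show ?thesis using 2 by (simp only: height_count_def simp_thms if_True)
  next
    case 3
    then have B: "?B = insert r' (?A - {r})" and r: "r \<in> ?A" and r': "r' \<notin> ?A"
      using d by (auto simp: drops_def)
    have "card ?B = Suc (card (?A - {r}))"
      unfolding B by (rule card_insert_disjoint) (use fin r' in blast)+
    then have "card ?A = card ?B" using card.remove[OF fin r] by linarith
    then show ?thesis
      using 3 by (simp only: height_count_def not_less[symmetric] simp_thms if_False add_0_right)
  qed
qed

lemma height_count_split:
  assumes "diagram D" "k \<le> r"
  shows "height_count D c k = height_count D c r + card {s. k \<le> s \<and> s < r \<and> (s, c) \<in> D}"
proof -
  have "{s. k \<le> s \<and> (s, c) \<in> D} =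
      {s. r \<le> s \<and> (s, c) \<in> D} \<union> {s. k \<le> s \<and> s < r \<and> (s, c) \<in> D}"
    using assms(2) by auto
  moreover have "finite {s. k \<le> s \<and> s < r \<and> (s, c) \<in> D}"
    by (rule finite_subset[of _ "{..r}"]) auto
  ultimately show ?thesis
    by (simp add: height_count_def card_Un_disjoint finite_column[OF assms(1)] disjoint_iff)
qed

text \<open>Column 0 of a diagram is empty, so the comparison has to start at column 1.\<close>

definition columns_dominate :: "cell set \<Rightarrow> bool" where
  "columns_dominate D \<longleftrightarrow> (\<forall>c \<ge> 1. \<forall>k. height_count D (Suc c) k \<le> height_count D c k)"

lemma columns_dominate_key_diagram: "columns_dominate (key_diagram a)"
  unfolding columns_dominate_def height_count_def
  by (auto intro!: card_mono finite_column diagram_key_diagram simp: mem_key_diagram)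

text \<open>Only counts of column \<open>c\<close> at levels \<open>k\<close> with
  \<open>r' < k\<close> and \<open>k \<le> r\<close> decrease, so strict inequality is needed there.
  Row \<open>r\<close> has a cell in column \<open>c\<close> but none in the next column, which
  gives strictness at level \<open>r\<close>; between \<open>r'\<close> and \<open>r\<close> column
  \<open>c\<close> is full, so strictness persists down to \<open>k\<close>.\<close>

lemma columns_dominate_drop:
  assumes d: "drops D r r' c" and D: "diagram D" and dom: "columns_dominate D"
  shows "columns_dominate (insert (r', c) (D - {(r, c)}))"
  unfolding columns_dominate_def
proof (intro allI impI)
  fix b k :: nat
  assume b: "1 \<le> b"
  let ?D' = "insert (r', c) (D - {(r, c)})"
  note hc = height_count_drop[OF d D]
  show "height_count ?D' (Suc b) k \<le> height_count ?D' b k"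
  proof (cases "b = c \<and> r' < k \<and> k \<le> r")
    case False
    then have "height_count ?D' (Suc b) k \<le> height_count D (Suc b) k"
      using hc[of "Suc b" k] by simp
    also have "\<dots> \<le> height_count D b k" using dom b by (simp add: columns_dominate_def)
    finally show ?thesis using hc[of b k] False by (auto split: if_splits)
  next
    case True
    have row: "height_count D x r = height_count D x (Suc r) + (if (r, x) \<in> D then 1 else 0)" for x
    proof -
      have "{s. r \<le> s \<and> s < Suc r \<and> (s, x) \<in> D} = (if (r, x) \<in> D then {r} else {})"
        by (auto simp: less_Suc_eq_le)
      then show ?thesis using height_count_split[OF D, of r "Suc r" x] by simp
    qed
    have "(r, Suc c) \<notin> D" "(r, c) \<in> D" using d by (fastforce simp: drops_def)+
    then have top: "height_count D (Suc c) r < height_count D c r"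
      using row[of c] row[of "Suc c"] dom b True by (simp add: columns_dominate_def less_Suc_eq_le)
    have "card {s. k \<le> s \<and> s < r \<and> (s, Suc c) \<in> D} \<le> card {s. k \<le> s \<and> s < r \<and> (s, c) \<in> D}"
      by (rule card_mono) (use d True in \<open>auto simp: drops_def intro: finite_subset[of _ "{..r}"]\<close>)
    then have "height_count D (Suc c) k < height_count D c k"
      using top True height_count_split[OF D, of k r] by simp
    then show ?thesis using hc[of b k] hc[of "Suc b" k] True by simp
  qed
qed

text \<open>The last invariant holds because a cell whose column is occupied at every row below it
  cannot drop.\<close>

lemma KD_key_diagram_props:
  assumes "D \<in> KD (key_diagram a)"
  shows "columns_dominate D"
    and "height_count D c k \<le> height_count (key_diagram a) c k"
    and "(\<And>i. 1 \<le> i \<Longrightarrow> i \<le> q \<Longrightarrow> (i, c) \<in> key_diagram a) \<Longrightarrow> 1 \<le> i \<Longrightarrow> i \<le> q \<Longrightarrow> (i, c) \<in> D"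
proof -
  have "kohnert_step\<^sup>*\<^sup>* (key_diagram a) D" using assms by (simp add: KD_def)
  then have "diagram D \<and> columns_dominate D \<and>
      (\<forall>c k. height_count D c k \<le> height_count (key_diagram a) c k) \<and>
      (\<forall>c q. (\<forall>i. 1 \<le> i \<longrightarrow> i \<le> q \<longrightarrow> (i, c) \<in> key_diagram a) \<longrightarrow>
        (\<forall>i. 1 \<le> i \<longrightarrow> i \<le> q \<longrightarrow> (i, c) \<in> D))"
  proof (induction rule: rtranclp_induct)
    case base
    show ?case by (simp add: diagram_key_diagram columns_dominate_key_diagram)
  next
    case (step D E)
    then have D: "diagram D" by simp
    show ?case
      using step.hyps(2) D
    proof (cases rule: kohnert_step_cases)
      case 1
      then show ?thesis using step.IH by simp
    next
      case (2 r r' c)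
      have "height_count E b k \<le> height_count D b k" for b k
        using height_count_drop[OF 2(1) D, of b k] 2(2) by simp
      moreover have "diagram E" using kohnert_step_props(1)[OF D step.hyps(2)] .
      moreover have "columns_dominate E"
        using columns_dominate_drop[OF 2(1) D] step.IH 2(2) by simp
      moreover have "(i, b) \<in> E"
        if full: "\<And>i. 1 \<le> i \<Longrightarrow> i \<le> q \<Longrightarrow> (i, b) \<in> D" and i: "1 \<le> i" "i \<le> q" for b q i
      proof -
        have "\<not> (b = c \<and> r \<le> q)" using full[of r'] 2(1) by (auto simp: drops_def)
        then show ?thesis using full[OF i] i 2(2) by auto
      qed
      ultimately show ?thesis using step.IH by (meson le_trans)
    qed
  qed
  then show "columns_dominate D"
    and "height_count D c k \<le> height_count (key_diagram a) c k"
    and "(\<And>i. 1 \<le> i \<Longrightarrow> i \<le> q \<Longrightarrow> (i, c) \<in> key_diagram a) \<Longrightarrow> 1 \<le> i \<Longrightarrow> i \<le> q \<Longrightarrow> (i, c) \<in> D"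
    by blast+
qed

lemma pattern_of_blocked_cell:
  assumes D: "D \<in> KD (key_diagram a)"
    and q: "1 \<le> q" "(q, c) \<notin> D"
    and s: "(Suc q, c) \<in> D" "(Suc q, c') \<in> D" "c < c'"
    and r: "(r, c) \<in> D" "Suc q < r"
  shows "\<exists>j p u. pattern a j p u"
proof -
  let ?K = "key_diagram a"
  have diag: "diagram D" using diagram_KD[OF D diagram_key_diagram] .
  then have c: "1 \<le> c" using s by (auto simp: diagram_def)
  \<comment> \<open>If column \<open>c\<close> of the key diagram were full up to row
    \<open>q\<close>, it would still be full there in \<open>D\<close>. The hole may lie below row
    \<open>q\<close>.\<close>
  obtain i where i: "1 \<le> i" "i \<le> q" "(i, c) \<notin> ?K"
    using KD_key_diagram_props(3)[OF D, of q c q] q by blast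
  have "card {Suc q, r} \<le> height_count D c (Suc q)"
    unfolding height_count_def
    by (rule card_mono) (use s r in \<open>auto intro: finite_column[OF diag]\<close>)
  then have two: "2 \<le> height_count ?K c (Suc q)"
    using KD_key_diagram_props(2)[OF D, of c "Suc q"] r by simp
  have "0 < height_count D c' (Suc q)" using s by (auto simp: height_count_pos[OF diag])
  \<comment> \<open>The blocking cell may be far to the right; domination, applied column by column,
    brings its count back to column \<open>Suc c\<close>.\<close>
  moreover have "height_count D c' (Suc q) \<le> height_count D (Suc c) (Suc q)"
    using s(3)[THEN Suc_leI]
  proof (induction c' rule: dec_induct)
    case (step n)
    have "height_count D (Suc n) (Suc q) \<le> height_count D n (Suc q)"
      using KD_key_diagram_props(1)[OF D] step.hyps(1) by (simp add: columns_dominate_def)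
    then show ?case using step.IH by simp
  qed simp
  ultimately have "0 < height_count ?K (Suc c) (Suc q)"
    using KD_key_diagram_props(2)[OF D, of "Suc c" "Suc q"] by simp
  then obtain x where x: "Suc q \<le> x" "(x, Suc c) \<in> ?K"
    by (auto simp: height_count_pos[OF diagram_key_diagram])
  \<comment> \<open>Row \<open>x\<close> reaches column \<open>Suc c\<close> and hence also column
    \<open>c\<close>. The count of two in column \<open>c\<close> supplies another row
    \<open>y\<close>.\<close>
  have "\<not> {y. Suc q \<le> y \<and> (y, c) \<in> ?K} \<subseteq> {x}"
  proof
    assume "{y. Suc q \<le> y \<and> (y, c) \<in> ?K} \<subseteq> {x}"
    from card_mono[OF _ this] show False using two by (simp add: height_count_def)
  qed
  then obtain y where y: "Suc q \<le> y" "(y, c) \<in> ?K" "y \<noteq> x" by blast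
  have ai: "a ! (i - 1) < c" "i - 1 < q"
    using i c x by (auto simp: mem_key_diagram not_le)
  show ?thesis
  proof (cases "x < y")
    case True
    then have "pattern a (i - 1) (x - 1) (y - 1)"
      using ai x y by (auto simp: pattern_def mem_key_diagram)
    then show ?thesis by blast
  next
    case False
    then have "pattern a (i - 1) (y - 1) (x - 1)"
      using ai x y by (auto simp: pattern_def mem_key_diagram)
    then show ?thesis by blast
  qed
qed

section \<open>Covers, and their effect on the row sum in the pure case\<close>

lemma covers_kohnert_step:
  assumes "covers (KD D0) (kohnert_order D0) D E"
  shows "D \<in> KD D0" "kohnert_step D E" "E \<noteq> D"
proof -
  show D: "D \<in> KD D0" and ne: "E \<noteq> D" using assms by (auto simp: covers_def)
  have "kohnert_step\<^sup>*\<^sup>* D E" using assms by (auto simp: covers_def kohnert_order_def)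
  then obtain Z where Z: "kohnert_step D Z" "Z \<noteq> D" "kohnert_step\<^sup>*\<^sup>* Z E"
    using steps_first ne by blast
  then have "Z \<in> KD D0" "E \<in> KD D0" using KD_steps[OF D, of Z] KD_steps[OF D, of E]
    by (auto intro: converse_rtranclp_into_rtranclp)
  \<comment> \<open>Otherwise \<open>Z\<close> would lie strictly between \<open>E\<close> and
    \<open>D\<close>.\<close>
  then have "Z = E" using assms Z D by (auto simp: covers_def kohnert_order_def)
  then show "kohnert_step D E" using Z by simp
qed

lemma row_sum_covers:
  assumes pure: "pure_composition a"
    and cov: "covers (KD (key_diagram a)) (kohnert_order (key_diagram a)) D E"
  shows "row_sum D = row_sum E + 1"
proof -
  note step = covers_kohnert_step[OF cov]
  have diag: "diagram D" using diagram_KD[OF step(1) diagram_key_diagram] .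
  obtain r r' c where d: "drops D r r' c" and E: "E = insert (r', c) (D - {(r, c)})"
    using kohnert_step_cases[OF step(2) diag] step(3) by metis
  have "r = Suc r'"
  proof (rule ccontr)
    assume "r \<noteq> Suc r'"
    then have r: "Suc r' < r" using d by (auto simp: drops_def)
    then have s: "(Suc r', c) \<in> D" using d by (auto simp: drops_def)
    have unblocked: "c' \<le> c" if "(Suc r', c') \<in> D" for c'
    proof (rule ccontr)
      assume "\<not> c' \<le> c"
      then have "\<exists>j p u. pattern a j p u"
        using d s r that by (intro pattern_of_blocked_cell[OF step(1), of r' c c' r]) (auto simp: drops_def)
      then show False using pure by (simp add: pure_composition_iff)
    qed
    txt \<open>An unblocked cell of the column can be dropped first, so that the jump factors.\<close>
    define Z where "Z = insert (r', c) (D - {(Suc r', c)})"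
    have "drops D (Suc r') r' c" using d s unblocked by (auto simp: drops_def)
    then have DZ: "kohnert_step D Z" unfolding Z_def by (rule kohnert_step_drops)
    have "drops Z r (Suc r') c" using d s r by (auto simp: drops_def Z_def)
    then have "kohnert_step Z (insert (Suc r', c) (Z - {(r, c)}))" by (rule kohnert_step_drops)
    moreover have "insert (Suc r', c) (Z - {(r, c)}) = E" using E s r by (auto simp: Z_def)
    ultimately have ZE: "kohnert_step Z E" by simp
    have "Z \<in> KD (key_diagram a)" "E \<in> KD (key_diagram a)"
      using step(1) KD_steps DZ step(2) by blast+
    then have "Z = D \<or> Z = E"
      using cov step(1) DZ ZE by (auto simp: covers_def kohnert_order_def)
    then show False using E s r d by (auto simp: Z_def drops_def)
  qed
  then show ?thesis using row_sum_drop[OF d diag] E by simp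
qed

section \<open>Two saturated chains of different lengths\<close>

text \<open>The condition on the row sums says that the cell falls by exactly one row; it also rules
  out moves that change nothing.\<close>

definition unit_step :: "cell set \<Rightarrow> cell set \<Rightarrow> bool" where
  "unit_step D E \<longleftrightarrow> kohnert_step D E \<and> row_sum D = row_sum E + 1"

lemma unit_steps_kohnert:
  assumes "unit_step\<^sup>*\<^sup>* D E"
  shows "kohnert_step\<^sup>*\<^sup>* D E"
  using assms by (rule rtranclp_mono[THEN predicate2D, rotated]) (auto simp: unit_step_def)

text \<open>An intermediate diagram would have its row sum strictly between two consecutive
  numbers.\<close>

lemma covers_unit_step:
  assumes D: "D \<in> KD D0" "diagram D0" and DE: "unit_step D E"
  shows "covers (KD D0) (kohnert_order D0) D E"
  unfolding covers_def
proof (intro conjI notI)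
  have s: "kohnert_step\<^sup>*\<^sup>* D E" using DE by (auto simp: unit_step_def)
  then show E: "E \<in> KD D0" using D KD_steps by blast
  show "D \<in> KD D0" by fact
  show "(E, D) \<in> kohnert_order D0" using D E s by (simp add: kohnert_order_def)
  show "E = D \<Longrightarrow> False" using DE by (simp add: unit_step_def)
  assume "\<exists>z\<in>KD D0. (E, z) \<in> kohnert_order D0 \<and> E \<noteq> z \<and> (z, D) \<in> kohnert_order D0 \<and> z \<noteq> D"
  then obtain z where "z \<in> KD D0" "kohnert_step\<^sup>*\<^sup>* z E" "E \<noteq> z" "kohnert_step\<^sup>*\<^sup>* D z" "z \<noteq> D"
    by (auto simp: kohnert_order_def)
  then show False
    using row_sum_less[of z E] row_sum_less[of D z] diagram_KD D DE by (auto simp: unit_step_def)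
qed

text \<open>Each unit step is a cover and so lowers \<open>\<rho>\<close> and \<open>row_sum\<close>
  by one each.\<close>

lemma unit_steps_rank:
  fixes \<rho> :: "cell set \<Rightarrow> nat"
  assumes rank: "\<And>D E. covers (KD D0) (kohnert_order D0) D E \<Longrightarrow> \<rho> D = \<rho> E + 1"
    and D: "D \<in> KD D0" "diagram D0" and DE: "unit_step\<^sup>*\<^sup>* D E"
  shows "\<rho> D + row_sum E = \<rho> E + row_sum D"
  using DE
proof (induction rule: rtranclp_induct)
  case (step E F)
  then have "E \<in> KD D0" using D KD_steps unit_steps_kohnert by blast
  then have "\<rho> E = \<rho> F + 1" using rank covers_unit_step D(2) step.hyps(2) by blast
  then show ?case using step by (simp add: unit_step_def)
qed simp

text \<open>Every move that changes the diagram lowers the row sum, so a total loss of one leaves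
  room for only one such move.\<close>

lemma steps_drop_one:
  assumes "kohnert_step\<^sup>*\<^sup>* D E" "diagram D" "row_sum D = row_sum E + 1"
  obtains r c where "drops D (Suc r) r c" "E = insert (r, c) (D - {(Suc r, c)})"
proof -
  have "E \<noteq> D" using assms(3) by auto
  then obtain Z where Z: "kohnert_step D Z" "Z \<noteq> D" "kohnert_step\<^sup>*\<^sup>* Z E"
    using steps_first assms(1) by blast
  obtain r r' c where d: "drops D r r' c" "Z = insert (r', c) (D - {(r, c)})"
    using kohnert_step_cases[OF Z(1) assms(2)] Z(2) by metis
  have "diagram Z" "row_sum Z < row_sum D" using kohnert_step_props(1,2)[OF assms(2) Z(1)] Z(2) by auto
  then have "Z = E" using row_sum_less[OF Z(3)] assms(3) by fastforce
  moreover from this have "r = Suc r'" using row_sum_drop[OF d(1) assms(2)] d(2) assms(3) by simp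
  ultimately show thesis using d that by blast
qed

text \<open>A diagram strictly between would split the jump into two one-row drops. The first
  vacates a position that \<open>E\<close> still contains, so the second refills it from the row
  above; comparison with \<open>E\<close> shows that the first moved \<open>(Suc q, c)\<close>,
  which is not the last cell of its row.\<close>

lemma covers_blocked_jump:
  assumes D: "D \<in> KD D0" "diagram D0"
    and d: "drops D (Suc (Suc q)) q c" and blocked: "(Suc q, c') \<in> D" "c < c'"
  defines "E \<equiv> insert (q, c) (D - {(Suc (Suc q), c)})"
  shows "covers (KD D0) (kohnert_order D0) D E" "row_sum D = row_sum E + 2"
proof -
  have diag: "diagram D" using diagram_KD D by blast
  show sum: "row_sum D = row_sum E + 2" using row_sum_drop[OF d diag] by (simp add: E_def)
  have s: "kohnert_step\<^sup>*\<^sup>* D E" using kohnert_step_drops[OF d] by (auto simp: E_def)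
  have E: "E \<in> KD D0" using D s KD_steps by blast
  have False
    if z: "z \<in> KD D0" "kohnert_step\<^sup>*\<^sup>* z E" "E \<noteq> z" "kohnert_step\<^sup>*\<^sup>* D z" "z \<noteq> D" for z
  proof -
    have zdiag: "diagram z" using diagram_KD z D by blast
    have "row_sum z = row_sum E + 1" "row_sum D = row_sum z + 1"
      using row_sum_less[OF z(2) zdiag z(3)] row_sum_less[OF z(4) diag z(5)] sum by auto
    then obtain s b t e where 1: "drops D (Suc s) s b" "z = insert (s, b) (D - {(Suc s, b)})"
      and 2: "drops z (Suc t) t e" "E = insert (t, e) (z - {(Suc t, e)})"
      using steps_drop_one[OF z(4) diag] steps_drop_one[OF z(2) zdiag] by metis
    \<comment> \<open>The upper cell cannot drop by one row first, because \<open>(Suc q, c)\<close>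
      is occupied.\<close>
    have "(Suc s, b) \<noteq> (Suc (Suc q), c)" using 1(1) d by (auto simp: drops_def)
    then have "(Suc s, b) \<in> E" using 1(1) by (auto simp: E_def drops_def)
    then have t: "t = Suc s" "e = b" using 1(2) 2(2) by auto
    then have "(s, b) \<in> E" using 1(2) 2(2) by auto
    then have "s = q" "b = c" using 1(1) by (auto simp: E_def drops_def)
    then show False using 1(1) blocked by (auto simp: drops_def)
  qed
  then show "covers (KD D0) (kohnert_order D0) D E"
    using D(1) E s sum by (auto simp: covers_def kohnert_order_def)
qed

lemma unit_steps_lower_row:
  assumes "diagram D" "1 \<le> r" "finite S" "{Suc r} \<times> S \<subseteq> D" "({r} \<times> S) \<inter> D = {}"
    and "\<And>x y. (Suc r, x) \<in> D \<Longrightarrow> x \<notin> S \<Longrightarrow> y \<in> S \<Longrightarrow> x < y"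
  shows "unit_step\<^sup>*\<^sup>* D (D - {Suc r} \<times> S \<union> {r} \<times> S)"
  using assms(3,1,2,4-)
proof (induction S arbitrary: D rule: finite_linorder_max_induct)
  case empty
  then show ?case by simp
next
  case (insert m S)
  let ?D' = "insert (r, m) (D - {(Suc r, m)})"
  have d: "drops D (Suc r) r m"
    unfolding drops_def
  proof (intro conjI allI impI)
    show "x \<le> m" if "(Suc r, x) \<in> D" for x
      using insert.prems(5)[OF that, of m] insert.hyps(2) by fastforce
  qed (use insert.prems in auto)
  have step: "kohnert_step D ?D'" using kohnert_step_drops[OF d] .
  have "unit_step D ?D'"
    using row_sum_drop[OF d insert.prems(1)] step by (simp add: unit_step_def)
  moreover have "unit_step\<^sup>*\<^sup>* ?D' (?D' - {Suc r} \<times> S \<union> {r} \<times> S)"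
  proof (rule insert.IH)
    show "diagram ?D'" using kohnert_step_props(1)[OF insert.prems(1) step] .
    show "x < y" if "(Suc r, x) \<in> ?D'" "x \<notin> S" "y \<in> S" for x y
      using insert.prems(5)[of x y] that by auto
  qed (use insert.prems insert.hyps(2) in auto)
  moreover have "?D' - {Suc r} \<times> S \<union> {r} \<times> S = D - {Suc r} \<times> insert m S \<union> {r} \<times> insert m S"
    by auto
  ultimately show ?case by (simp add: converse_rtranclp_into_rtranclp)
qed

lemma no_rank_three_rows:
  fixes \<rho> :: "cell set \<Rightarrow> nat"
  assumes rank: "\<And>D E. covers (KD D0) (kohnert_order D0) D E \<Longrightarrow> \<rho> D = \<rho> E + 1"
    and D: "D \<in> KD D0" "diagram D0" and q: "1 \<le> q"
    and row: "\<And>x. c \<le> x \<Longrightarrow> (q, x) \<notin> D"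
    and c: "(Suc q, c) \<in> D" "(Suc (Suc q), c) \<in> D"
    and y: "(Suc q, y) \<in> D \<or> (Suc (Suc q), y) \<in> D" "c < y"
  shows False
proof -
  define S where "S = {x. c \<le> x \<and> (Suc q, x) \<in> D}"
  define T where "T = {x. c \<le> x \<and> (Suc (Suc q), x) \<in> D}"
  define E1 where "E1 = D - {Suc q} \<times> S \<union> {q} \<times> S"
  define E where "E = E1 - {Suc (Suc q)} \<times> T \<union> {Suc q} \<times> T"
  have diag: "diagram D" using diagram_KD D by blast
  have KD: "F \<in> KD D0" "diagram F" if "unit_step\<^sup>*\<^sup>* D F" for F
    using that KD_steps[OF D(1)] diagram_KD D(2) unit_steps_kohnert by blast+
  have "S \<subseteq> snd ` D" "T \<subseteq> snd ` D" by (force simp: S_def T_def)+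
  then have fin: "finite S" "finite T"
    using diag by (auto simp: diagram_def intro: finite_subset)
  have cST: "c \<in> S" "c \<in> T" using c by (auto simp: S_def T_def)
  have DE1: "unit_step\<^sup>*\<^sup>* D E1"
    unfolding E1_def using diag q fin row
    by (intro unit_steps_lower_row) (auto simp: S_def)
  have "unit_step\<^sup>*\<^sup>* E1 E"
    unfolding E_def using KD[OF DE1] q fin
    by (intro unit_steps_lower_row) (auto simp: S_def T_def E1_def)
  with DE1 have "unit_step\<^sup>*\<^sup>* D E" by simp
  have \<rho>_unit: "\<rho> F + row_sum F' = \<rho> F' + row_sum F"
    if "F \<in> KD D0" "unit_step\<^sup>*\<^sup>* F F'" for F F'
    using unit_steps_rank[OF _ that(1) D(2) that(2)] rank by blast
  note \<rho>_DE = \<rho>_unit[OF D(1) \<open>unit_step\<^sup>*\<^sup>* D E\<close>]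
  show False
  proof (cases "T = {c}")
    case False
    \<comment> \<open>Both rows are lowered except in column \<open>c\<close>. The cells that came
      down from the upper row now block \<open>(Suc q, c)\<close>, and the upper cell of column
      \<open>c\<close> jumps over it. Up to the resulting diagram this equals dropping both cells by
      one.\<close>
    define A where "A = D - {Suc q} \<times> (S - {c}) \<union> {q} \<times> (S - {c})"
    define B where "B = A - {Suc (Suc q)} \<times> (T - {c}) \<union> {Suc q} \<times> (T - {c})"
    obtain c' where c': "c' \<in> T" "c < c'" using False cST(2) by (force simp: T_def)
    have DA: "unit_step\<^sup>*\<^sup>* D A"
      unfolding A_def using diag q fin row
      by (intro unit_steps_lower_row) (auto simp: S_def)
    have "unit_step\<^sup>*\<^sup>* A B"
      unfolding B_def using KD[OF DA] q fin
      by (intro unit_steps_lower_row) (auto simp: S_def T_def A_def)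
    with DA have DB: "unit_step\<^sup>*\<^sup>* D B" by simp
    have "drops B (Suc (Suc q)) q c"
      unfolding drops_def
    proof (intro conjI allI impI)
      show "(q, c) \<notin> B" using row[of c] by (auto simp: A_def B_def)
      show "x \<le> c" if "(Suc (Suc q), x) \<in> B" for x
        using that by (auto simp: A_def B_def T_def)
      show "(s, c) \<in> B" if "q < s" "s < Suc (Suc q)" for s
      proof -
        have "s = Suc q" using that by simp
        then show ?thesis using c by (auto simp: A_def B_def)
      qed
    qed (use q c in \<open>auto simp: A_def B_def\<close>)
    note jump = covers_blocked_jump[OF KD(1)[OF DB] D(2) this, of c']
    have "insert (q, c) (B - {(Suc (Suc q), c)}) = E"
      using cST c by (auto simp: A_def B_def E_def E1_def)
    then have "covers (KD D0) (kohnert_order D0) B E" "row_sum B = row_sum E + 2"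
      using jump c' by (auto simp: B_def)
    then show False using rank[of B E] \<rho>_unit[OF D(1) DB] \<rho>_DE by simp
  next
    case True
    \<comment> \<open>Here \<open>c\<close> ends the upper row and \<open>y\<close> blocks the lower
      one, so the jump comes first; the lower row is then lowered except in column
      \<open>c\<close>.\<close>
    define A where "A = insert (q, c) (D - {(Suc (Suc q), c)})"
    have y': "(Suc q, y) \<in> D" using y True by (auto simp: T_def)
    have "drops D (Suc (Suc q)) q c"
      unfolding drops_def
    proof (intro conjI allI impI)
      show "x \<le> c" if "(Suc (Suc q), x) \<in> D" for x
      proof (rule ccontr)
        assume "\<not> x \<le> c"
        then have "x \<in> T" using that by (simp add: T_def)
        then show False using True \<open>\<not> x \<le> c\<close> by simp
      qed
      show "(s, c) \<in> D" if "q < s" "s < Suc (Suc q)" for s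
      proof -
        have "s = Suc q" using that by simp
        then show ?thesis using c by simp
      qed
    qed (use q c row in auto)
    note jump = this covers_blocked_jump[OF D this y' y(2), folded A_def]
    then have "A \<in> KD D0" using KD_steps[OF D(1)] kohnert_step_drops A_def by blast
    then have A: "A \<in> KD D0" "diagram A" using diagram_KD D(2) by blast+
    have "unit_step\<^sup>*\<^sup>* A (A - {Suc q} \<times> (S - {c}) \<union> {q} \<times> (S - {c}))"
      using A q fin row
      by (intro unit_steps_lower_row) (auto simp: S_def A_def)
    also have "A - {Suc q} \<times> (S - {c}) \<union> {q} \<times> (S - {c}) = E"
      unfolding A_def E_def E1_def True using cST(1) c by auto
    finally have "\<rho> A + row_sum E = \<rho> E + row_sum A"
      using \<rho>_unit[OF A(1)] by blast
    then show False using rank[OF jump(2)] jump(3) \<rho>_DE by simp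
  qed
qed

section \<open>Extremal patterns and the reduction to three rows\<close>

lemma obtain_extremal_pattern:
  assumes "pattern a j0 p0 u0"
  obtains j p u where "pattern a j p u"
    and "\<And>i. j < i \<Longrightarrow> i < p \<Longrightarrow> a ! i = Suc (a ! j) \<and> a ! p = Suc (a ! j)"
    and "\<And>i. p < i \<Longrightarrow> i < u \<Longrightarrow> a ! i \<le> a ! j"
proof -
  \<comment> \<open>The choice is lexicographic: \<open>u\<close> is minimal, then \<open>j\<close>
    maximal, then \<open>p\<close> maximal.\<close>
  define u where "u = (LEAST u. \<exists>j p. pattern a j p u)"
  have "\<exists>j p. pattern a j p u"
    unfolding u_def by (rule LeastI_ex) (use assms in blast)
  moreover have u: "u \<le> u'" if "pattern a j p u'" for j p u'
    unfolding u_def by (rule Least_le) (use that in blast)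
  moreover define j where "j = Max {j. \<exists>p. pattern a j p u}"
  moreover have finj: "finite {j. \<exists>p. pattern a j p u}"
    by (rule finite_subset[of _ "{..u}"]) (auto simp: pattern_def)
  ultimately have "\<exists>p. pattern a j p u"
    using Max_in[OF finj] by blast
  moreover have j: "j' \<le> j" if "pattern a j' p u" for j' p
    using Max_ge[OF finj] that by (auto simp: j_def)
  moreover define p where "p = Max {p. pattern a j p u}"
  moreover have finp: "finite {p. pattern a j p u}"
    by (rule finite_subset[of _ "{..u}"]) (auto simp: pattern_def)
  ultimately have pat: "pattern a j p u"
    using Max_in[OF finp] by blast
  have p: "p' \<le> p" if "pattern a j p' u" for p'
    using Max_ge[OF finp] that by (auto simp: p_def)
  show thesis
  proof (rule that[OF pat])
    fix i assume i: "j < i" "i < p"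
    \<comment> \<open>Since \<open>j\<close> is maximal, \<open>a ! i\<close> exceeds
      \<open>a ! j\<close>; since \<open>u\<close> is minimal, neither \<open>a ! i\<close> nor
      \<open>a ! p\<close> exceeds it by more than one.\<close>
    have "\<not> pattern a i p u" "\<not> pattern a j i p"
      using j[of i p] u[of j i p] i pat by (auto simp: pattern_def)
    then show "a ! i = Suc (a ! j) \<and> a ! p = Suc (a ! j)"
      using i pat unfolding pattern_def by linarith
  next
    fix i assume i: "p < i" "i < u"
    \<comment> \<open>If \<open>a ! i\<close> exceeded \<open>a ! j\<close>, minimality of
      \<open>u\<close> would make it and \<open>a ! p\<close> equal to \<open>Suc (a ! j)\<close>.
      Then \<open>a ! u\<close> is larger still, and \<open>i\<close> could replace
      \<open>p\<close>.\<close>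
    have "\<not> pattern a j p i" "\<not> pattern a j i u"
      using p[of i] u[of j p i] i by auto
    then show "a ! i \<le> a ! j"
      using i pat unfolding pattern_def by linarith
  qed
qed

text \<open>List position \<open>i\<close> is row \<open>Suc i\<close>, so \<open>p\<close> is the
  row just below that of the part \<open>a ! p\<close>. It serves as the lowest of the three
  rows.\<close>

lemma no_rank_pattern:
  fixes \<rho> :: "cell set \<Rightarrow> nat"
  assumes rank: "\<And>D E. covers (KD (key_diagram a)) (kohnert_order (key_diagram a)) D E \<Longrightarrow>
      \<rho> D = \<rho> E + 1"
    and "pattern a j0 p0 u0"
  shows False
proof -
  let ?K = "key_diagram a"
  obtain j p u where pat: "pattern a j p u"
    and jp: "\<And>i. j < i \<Longrightarrow> i < p \<Longrightarrow> a ! i = Suc (a ! j) \<and> a ! p = Suc (a ! j)"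
    and pu: "\<And>i. p < i \<Longrightarrow> i < u \<Longrightarrow> a ! i \<le> a ! j"
    using obtain_extremal_pattern[OF assms(2)] by metis
  define c where "c = Suc (a ! j)"
  have b: "j < p" "p < u" "u < length a" "c \<le> a ! p" "c \<le> a ! u" "c < a ! p \<or> c < a ! u" "1 \<le> c"
    using pat by (auto simp: pattern_def c_def)
  have KD: "F \<in> KD ?K" "diagram F" if "unit_step\<^sup>*\<^sup>* ?K F" for F
    using that diagram_KD[OF _ diagram_key_diagram] unit_steps_kohnert by (auto simp: KD_def)
  txt \<open>The hole in column \<open>c\<close> of row \<open>j + 1\<close> moves up to the row just below row \<open>p + 1\<close>.\<close>
  define G where "G i = insert (Suc j, c) ?K - {(i, c)}" for i
  have "unit_step\<^sup>*\<^sup>* ?K (G i)" if "Suc j \<le> i" "i \<le> p" for i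
    using that
  proof (induction i rule: dec_induct)
    case base
    have "G (Suc j) = ?K" by (auto simp: G_def mem_key_diagram c_def)
    then show ?case by simp
  next
    case (step i)
    then have KG: "unit_step\<^sup>*\<^sup>* ?K (G i)" by simp
    \<comment> \<open>Row \<open>Suc i\<close> lies strictly between rows \<open>Suc j\<close> and
      \<open>Suc p\<close>, so it ends in column \<open>c\<close> and its last cell can drop into
      the hole.\<close>
    have ai: "a ! i = c" using jp[of i] step by (simp add: c_def)
    have mem: "(Suc i, x) \<in> G i \<longleftrightarrow> 1 \<le> x \<and> x \<le> c" for x
      using step b ai by (auto simp: G_def mem_key_diagram)
    have "unit_step\<^sup>*\<^sup>* (G i) (G i - {Suc i} \<times> {c} \<union> {i} \<times> {c})"
      by (rule unit_steps_lower_row)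
        (use KD[OF KG] step b in \<open>auto simp: mem, auto simp: G_def\<close>)
    also have "G i - {Suc i} \<times> {c} \<union> {i} \<times> {c} = G (Suc i)"
    proof -
      have "(i, c) \<in> insert (Suc j, c) ?K"
        using step b jp[of "i - 1"] by (cases "i = Suc j") (auto simp: mem_key_diagram c_def)
      then show ?thesis by (auto simp: G_def)
    qed
    finally show ?case using KG by simp
  qed
  then have KG: "unit_step\<^sup>*\<^sup>* ?K (G p)" using b by simp
  \<comment> \<open>Row \<open>p\<close> is either the short row \<open>Suc j\<close> itself or a
    row of length \<open>c\<close> that has lost its last cell.\<close>
  have G_low: "(p, x) \<notin> G p" if "c \<le> x" for x
    using that b jp[of "p - 1"] by (cases "p = Suc j") (auto simp: G_def mem_key_diagram c_def)
  have G_high: "(i, x) \<in> G p \<longleftrightarrow> (i, x) \<in> ?K" if "p < i" for i x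
    using that b by (auto simp: G_def)
  txt \<open>The part of row \<open>u + 1\<close> to the right of column \<open>a ! j\<close> moves down onto row \<open>p + 1\<close>.\<close>
  define S where "S = {c..a ! u}"
  define H where "H i = G p - {Suc u} \<times> S \<union> {i} \<times> S" for i
  have Gu: "{Suc u} \<times> S \<subseteq> G p" using b by (auto simp: G_high mem_key_diagram S_def)
  have G_mid: "(i, x) \<notin> G p" if "Suc p < i" "i < Suc u" "c \<le> x" for i x
  proof -
    have "p < i - 1" "i - 1 < u" using that by auto
    then show ?thesis using that pu[of "i - 1"] by (auto simp: G_high mem_key_diagram c_def)
  qed
  have "unit_step\<^sup>*\<^sup>* (G p) (H i)" if "i \<le> Suc u" "Suc (Suc p) \<le> i" for i
    using that
  proof (induction i rule: inc_induct)
    case base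
    have "H (Suc u) = G p" using Gu by (auto simp: H_def)
    then show ?case by simp
  next
    case (step i)
    then have GH: "unit_step\<^sup>*\<^sup>* (G p) (H (Suc i))" by simp
    then have KH: "unit_step\<^sup>*\<^sup>* ?K (H (Suc i))" using KG by simp
    \<comment> \<open>Only the original row \<open>Suc u\<close> reaches column \<open>c\<close>
      here, and its part from there on is \<open>S\<close>; the other rows on the way down are
      shorter.\<close>
    have mid: "i = u" if "(Suc i, x) \<in> G p" "c \<le> x" for x
      using that step.hyps G_mid[of "Suc i" x] step.prems by linarith
    have row: "x < c" if "(Suc i, x) \<in> H (Suc i)" "x \<notin> S" for x
    proof (rule ccontr)
      assume "\<not> x < c"
      then have "(Suc i, x) \<in> G p" "c \<le> x" using that by (auto simp: H_def)
      moreover from this have "i = u" by (rule mid)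
      ultimately show False
        using that(2) b by (simp add: G_high mem_key_diagram S_def)
    qed
    have "unit_step\<^sup>*\<^sup>* (H (Suc i)) (H (Suc i) - {Suc i} \<times> S \<union> {i} \<times> S)"
    proof (rule unit_steps_lower_row)
      show "({i} \<times> S) \<inter> H (Suc i) = {}"
        using step G_mid[of i] by (auto simp: H_def S_def)
      show "x < y" if "(Suc i, x) \<in> H (Suc i)" "x \<notin> S" "y \<in> S" for x y
        using row[OF that(1,2)] that(3) by (simp add: S_def)
    qed (use KD[OF KH] step in \<open>auto simp: H_def S_def\<close>)
    also have "H (Suc i) - {Suc i} \<times> S \<union> {i} \<times> S = H i"
      using mid by (auto simp: H_def S_def)
    finally show ?case using GH by simp
  qed
  then have "unit_step\<^sup>*\<^sup>* (G p) (H (Suc (Suc p)))" using b by simp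
  with KG have "unit_step\<^sup>*\<^sup>* ?K (H (Suc (Suc p)))" by (rule rtranclp_trans)
  note KH = KD[OF this]
  have H_row: "(Suc p, x) \<in> H (Suc (Suc p)) \<longleftrightarrow> 1 \<le> x \<and> x \<le> a ! p"
    and H_top: "c \<le> x \<Longrightarrow> x \<le> a ! u \<Longrightarrow> (Suc (Suc p), x) \<in> H (Suc (Suc p))" for x
    using b by (auto simp: H_def G_high mem_key_diagram S_def)
  \<comment> \<open>One of the two parts exceeds \<open>c\<close>, so \<open>Suc c\<close> is a
    column occupied in one of the two upper rows.\<close>
  show False
  proof (rule no_rank_three_rows[where \<rho> = \<rho> and q = p and c = c and y = "Suc c",
        OF _ KH(1) diagram_key_diagram])
    show "\<rho> D = \<rho> E + 1" if "covers (KD ?K) (kohnert_order ?K) D E" for D E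
      using that by (rule rank)
    show "(p, x) \<notin> H (Suc (Suc p))" if "c \<le> x" for x
      using G_low[OF that] by (simp add: H_def)
  qed (use b in \<open>auto simp: H_row H_top\<close>)
qed

theorem theorem6p5:
  fixes a :: "nat list"
  shows "ranked (KD (key_diagram a)) (kohnert_order (key_diagram a)) \<longleftrightarrow> pure_composition a"
proof
  assume "ranked (KD (key_diagram a)) (kohnert_order (key_diagram a))"
  then obtain \<rho> :: "cell set \<Rightarrow> nat" where
    "\<forall>x \<in> KD (key_diagram a). \<forall>y \<in> KD (key_diagram a).
      covers (KD (key_diagram a)) (kohnert_order (key_diagram a)) y x \<longrightarrow> \<rho> y = \<rho> x + 1"
    by (auto simp: ranked_def)
  then have "\<rho> D = \<rho> E + 1"
    if "covers (KD (key_diagram a)) (kohnert_order (key_diagram a)) D E" for D E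
    using that by (simp add: covers_def)
  then show "pure_composition a"
    using no_rank_pattern unfolding pure_composition_iff by blast
next
  assume pure: "pure_composition a"
  show "ranked (KD (key_diagram a)) (kohnert_order (key_diagram a))"
    unfolding ranked_def
  proof (intro exI[of _ row_sum] conjI ballI impI)
    fix D E
    assume "D \<in> KD (key_diagram a)" "E \<in> KD (key_diagram a)"
      and "(D, E) \<in> kohnert_order (key_diagram a) \<and> D \<noteq> E"
    then show "row_sum D < row_sum E"
      using row_sum_less diagram_KD[OF _ diagram_key_diagram] by (auto simp: kohnert_order_def)
  next
    fix D E
    assume "covers (KD (key_diagram a)) (kohnert_order (key_diagram a)) E D"
    then show "row_sum E = row_sum D + 1" by (rule row_sum_covers[OF pure])
  qed
qed

end
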